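(* Let $\sigma$ be a unimodular morphism of $F_d$. If the image of a stepped surface under $E_1^*(\sigma)$ is a binary stepped function, then it is a stepped surface: $E_1^*(\sigma)(\mathfrak{S})\cap\mathfrak{B}\subset\mathfrak{S}$.
   Context: Fix an integer $d\geq 3$; $(\vec{e}_1,\ldots,\vec{e}_d)$ is the canonical basis of $\mathbb{R}^d$. A stepped function is a function $\mathcal{E}:\mathbb{Z}^d\times\{1,\ldots,d\}\to\mathbb{Z}$; the set of stepped functions is denoted $\mathfrak{F}$. It is binary if it takes only the values $0$ and $1$; $\mathfrak{B}$ is the set of binary stepped functions. The geometric interpretation of $\mathcal{B}\in\mathfrak{B}$ is the union, over all $(\vec{x},i)$ with $\mathcal{B}(\vec{x},i)=1$, of the facets $\{\vec{x}+\vec{e}_i+\sum_{j\neq i}\lambda_j\vec{e}_j \mid 0\leq\lambda_j\leq 1\}$. Let $\pi$ be the orthogonal projection of $\mathbb{R}^d$ onto $\Delta=\{\vec{x} \mid x_1+\cdots+x_d=0\}$. A stepped surface is a binary stepped function whose geometric interpretation is homeomorphic to $\Delta$ under $\pi$ (i.e. the restriction of $\pi$ to it is a homeomorphism onto $\Delta$); $\mathfrak{S}$ is the set of stepped surfaces. $F_d$ is the free group on the alphabet $\{1,\ldots,d\}$; its elements are written in reduced form. The Abelianization map $\vec{f}:F_d\to\mathbb{Z}^d$ sends $w$ to the vector whose $i$-th entry is the sum of the exponents of the occurrences of $i$ in $w$. A morphism $\sigma$ of $F_d$ is a group endomorphism; its incidence matrix $M_\sigma$ is the $d\times d$ integer matrix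 whose $i$-th column is $\vec{f}(\sigma(i))$; $\sigma$ is unimodular if $\det M_\sigma=\pm 1$. The dual map $E_1^*(\sigma):\mathfrak{F}\to\mathfrak{F}$ of a unimodular morphism $\sigma$ is defined by $$E_1^*(\sigma)(\mathcal{E})(\vec{x},i)=\sum_{\sigma(i)=p\cdot j\cdot s}\mathcal{E}(M_\sigma\vec{x}+\vec{f}(p),j)-\sum_{\sigma(i)=p\cdot j^{-1}\cdot s}\mathcal{E}(M_\sigma\vec{x}+\vec{f}(p)-\vec{e}_j,j),$$ where the first (resp. second) sum ranges over all occurrences in the reduced word $\sigma(i)$ of letters $j$ (resp. inverse letters $j^{-1}$), $1\leq j\leq d$, with $p$ the prefix before and $s$ the suffix after that occurrence. *)

theory Defs
  imports "HOL-Analysis.Analysis" "HOL-Algebra.Group"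
begin

section \<open>The free group on a finite alphabet, as reduced words\<close>

datatype 'd letter = Pos 'd | Neg 'd

type_synonym 'd word = "'d letter list"

fun inv_letter :: "'d letter \<Rightarrow> 'd letter" where
  "inv_letter (Pos i) = Neg i"
| "inv_letter (Neg i) = Pos i"

definition reduced_word :: "'d word \<Rightarrow> bool" where
  "reduced_word w \<longleftrightarrow> successively (\<lambda>a b. b \<noteq> inv_letter a) w"

fun cancel_Cons :: "'d letter \<Rightarrow> 'd word \<Rightarrow> 'd word" where
  "cancel_Cons a [] = [a]"
| "cancel_Cons a (b # w) = (if b = inv_letter a then w else a # b # w)"

definition reduce :: "'d word \<Rightarrow> 'd word" where
  "reduce w = foldr cancel_Cons w []"

definition free_group :: "'d word monoid" where
  "free_group = \<lparr>carrier = {w. reduced_word w}, mult = (\<lambda>u v. reduce (u @ v)), one = []\<rparr>"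

lemma inv_letter_inv_letter [simp]: "inv_letter (inv_letter a) = a"
  by (cases a) auto

lemma inv_letter_neq [simp]: "inv_letter a \<noteq> a" "a \<noteq> inv_letter a"
  by (cases a; simp)+

lemma reduced_Nil [simp]: "reduced_word []"
  by (simp add: reduced_word_def)

lemma reduced_Cons: "reduced_word (a # w) \<longleftrightarrow> reduced_word w \<and> (w = [] \<or> hd w \<noteq> inv_letter a)"
  by (auto simp: reduced_word_def successively_Cons)

lemma reduced_cancel_Cons: "reduced_word w \<Longrightarrow> reduced_word (cancel_Cons a w)"
  by (cases w) (auto simp: reduced_Cons)

lemma cancel_Cons_inverse:
  assumes "reduced_word w"
  shows "cancel_Cons (inv_letter a) (cancel_Cons a w) = w"
proof (cases w)
  case (Cons b v)
  then show ?thesis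
    using assms by (cases v) (auto simp: reduced_Cons)
qed auto

lemma cancel_Cons_inverse':
  assumes "reduced_word w"
  shows "cancel_Cons a (cancel_Cons (inv_letter a) w) = w"
  using cancel_Cons_inverse[OF assms, of "inv_letter a"] by simp

lemma reduced_foldr: "reduced_word v \<Longrightarrow> reduced_word (foldr cancel_Cons w v)"
  by (induction w) (auto simp: reduced_cancel_Cons)

lemma reduced_reduce: "reduced_word (reduce w)"
  by (simp add: reduce_def reduced_foldr)

lemma reduce_reduced: "reduced_word w \<Longrightarrow> reduce w = w"
proof (induction w)
  case (Cons a w)
  then have "cancel_Cons a w = a # w"
    by (cases w) (auto simp: reduced_Cons)
  with Cons show ?case
    by (simp add: reduce_def reduced_Cons)
qed (simp add: reduce_def)

lemma foldr_cancel_Cons: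
  assumes "reduced_word v"
  shows "foldr cancel_Cons (cancel_Cons a w) v = cancel_Cons a (foldr cancel_Cons w v)"
  using assms by (cases w) (auto simp: cancel_Cons_inverse' reduced_foldr)

lemma foldr_reduce:
  assumes "reduced_word v"
  shows "foldr cancel_Cons (reduce u) v = foldr cancel_Cons u v"
  using assms by (induction u) (auto simp: reduce_def foldr_cancel_Cons)

lemma reduce_append: "reduce (u @ v) = foldr cancel_Cons u (reduce v)"
  by (simp add: reduce_def)

lemma reduce_reduce_append: "reduce (reduce u @ v) = reduce (u @ v)"
  by (simp add: reduce_append foldr_reduce reduced_reduce)

lemma reduce_append_reduce: "reduce (u @ reduce v) = reduce (u @ v)"
  by (simp add: reduce_append reduce_reduced reduced_reduce)

lemma reduce_inverse: "reduce (rev (map inv_letter w) @ w) = []"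
proof (induction w)
  case (Cons a w)
  then show ?case
    by (simp add: reduce_append cancel_Cons_inverse reduced_reduce)
       (simp add: reduce_def cancel_Cons_inverse reduced_foldr)
qed (simp add: reduce_def)

lemma group_free_group: "group free_group"
proof (rule groupI)
  fix w :: "'a word" assume "w \<in> carrier free_group"
  have "reduce (reduce (rev (map inv_letter w)) @ w) = []"
    by (simp add: reduce_reduce_append reduce_inverse)
  then show "\<exists>v\<in>carrier free_group. v \<otimes>\<^bsub>free_group\<^esub> w = \<one>\<^bsub>free_group\<^esub>"
    by (intro bexI[of _ "reduce (rev (map inv_letter w))"]) (auto simp: free_group_def reduced_reduce)
qed (auto simp: free_group_def reduced_reduce reduce_reduced reduce_reduce_append
       reduce_append_reduce)


section \<open>Abelianization and incidence matrices\<close>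

fun letter_vec :: "'d::finite letter \<Rightarrow> int ^ 'd" where
  "letter_vec (Pos i) = axis i 1"
| "letter_vec (Neg i) = - axis i 1"

definition abelianization :: "'d::finite word \<Rightarrow> int ^ 'd" where
  "abelianization w = (\<Sum>a\<leftarrow>w. letter_vec a)"

text \<open>The column with index \<open>i\<close> is the Abelianization of the image of the generator \<open>i\<close>.\<close>

definition incidence_matrix :: "('d::finite word \<Rightarrow> 'd word) \<Rightarrow> int ^ 'd ^ 'd" where
  "incidence_matrix \<sigma> = (\<chi> k i. abelianization (\<sigma> [Pos i]) $ k)"

definition unimodular :: "('d::finite word \<Rightarrow> 'd word) \<Rightarrow> bool" where
  "unimodular \<sigma> \<longleftrightarrow> det (incidence_matrix \<sigma>) = 1 \<or> det (incidence_matrix \<sigma>) = - 1"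


section \<open>Stepped functions and stepped surfaces\<close>

type_synonym 'd stepped_function = "(int ^ 'd) \<times> 'd \<Rightarrow> int"

definition binary_functions :: "'d::finite stepped_function set" where
  "binary_functions = {B. \<forall>x i. B (x, i) \<in> {0, 1}}"

definition facet :: "int ^ 'd::finite \<Rightarrow> 'd \<Rightarrow> (real ^ 'd) set" where
  "facet x i = {(\<chi> k. real_of_int (x $ k)) + axis i 1 + (\<Sum>j\<in>UNIV - {i}. c j *\<^sub>R axis j 1) |c.
                 \<forall>j\<in>UNIV - {i}. 0 \<le> c j \<and> c j \<le> 1}"

definition geometric_interpretation :: "'d::finite stepped_function \<Rightarrow> (real ^ 'd) set" where
  "geometric_interpretation B = (\<Union>(x, i)\<in>{(x, i). B (x, i) = 1}. facet x i)"

definition diagonal_plane :: "(real ^ 'd::finite) set" where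
  "diagonal_plane = {x. (\<Sum>k\<in>UNIV. x $ k) = 0}"

definition diagonal_projection :: "real ^ 'd::finite \<Rightarrow> real ^ 'd" where
  "diagonal_projection x = (\<chi> k. x $ k - (\<Sum>l\<in>UNIV. x $ l) / real CARD('d))"

text \<open>The next two facts characterize the orthogonal projection onto the plane.\<close>

lemma diagonal_projection_in_plane: "diagonal_projection x \<in> diagonal_plane"
  by (simp add: diagonal_projection_def diagonal_plane_def sum_subtractf)

lemma diagonal_projection_orthogonal:
  fixes x y :: "real ^ 'd::finite"
  assumes "y \<in> diagonal_plane"
  shows "(x - diagonal_projection x) \<bullet> y = 0"
proof -
  have "(x - diagonal_projection x) \<bullet> y =
      (\<Sum>k\<in>UNIV. (\<Sum>l\<in>UNIV. x $ l) / real CARD('d) * y $ k)"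
    by (simp add: diagonal_projection_def inner_vec_def)
  also have "\<dots> = (\<Sum>l\<in>UNIV. x $ l) / real CARD('d) * (\<Sum>k\<in>UNIV. y $ k)"
    by (rule sum_distrib_left [symmetric])
  finally show ?thesis
    using assms by (simp add: diagonal_plane_def)
qed

definition stepped_surfaces :: "'d::finite stepped_function set" where
  "stepped_surfaces = {B \<in> binary_functions.
     \<exists>g. homeomorphism (geometric_interpretation B) diagonal_plane diagonal_projection g}"


section \<open>Dual maps\<close>

text \<open>The sum runs over the positions \<open>n\<close> of the reduced word \<open>\<sigma> [Pos i]\<close>; the prefix before
  the occurrence at position \<open>n\<close> is \<open>take n (\<sigma> [Pos i])\<close>.\<close>

definition dual_map ::
    "('d::finite word \<Rightarrow> 'd word) \<Rightarrow> 'd stepped_function \<Rightarrow> 'd stepped_function" where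
  "dual_map \<sigma> E = (\<lambda>(x, i).
     \<Sum>n<length (\<sigma> [Pos i]).
       let y = incidence_matrix \<sigma> *v x + abelianization (take n (\<sigma> [Pos i]))
       in case \<sigma> [Pos i] ! n of
            Pos j \<Rightarrow> E (y, j)
          | Neg j \<Rightarrow> - E (y - axis j 1, j))"

end

theory Submission
  imports Defs
begin

text \<open>The facet \<open>(x, i)\<close> is the common face of the unit cubes at \<open>x\<close> and \<open>x + e\<^sub>i\<close>, so a stepped
  function is a 1-cochain on the lattice graph of \<open>\<int>\<^sup>d\<close>. A binary stepped function is a stepped surface
  iff it is the coboundary of the indicator function of a set \<open>U\<close> with \<open>\<emptyset> \<noteq> U \<noteq> \<int>\<^sup>d\<close>, namely the set of
  cubes above the surface. The dual map evaluates cochains along lattice paths and hence sends the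
  coboundary of \<open>U\<close> to that of its preimage under the incidence matrix, which permutes \<open>\<int>\<^sup>d\<close>.\<close>

section \<open>Coboundaries of indicator functions\<close>

definition coboundary :: "(int ^ 'd::finite) set \<Rightarrow> 'd stepped_function" where
  "coboundary U = (\<lambda>(x, i). of_bool (x + axis i 1 \<in> U) - of_bool (x \<in> U))"

text \<open>The word \<open>\<sigma> [Pos i]\<close> spells a lattice path starting at
  \<open>M *v x\<close>, each letter contributing one increment of the indicator of
  \<open>U\<close>, so the sum telescopes. An inverse letter walks an edge backwards, which is why
  \<open>dual_map\<close> subtracts there and shifts by \<open>axis j 1\<close>.\<close>

lemma dual_map_coboundary:
  "dual_map \<sigma> (coboundary U) = coboundary {x. incidence_matrix \<sigma> *v x \<in> U}"
proof (rule ext, clarify)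
  fix x and i :: 'a
  define w where "w = \<sigma> [Pos i]"
  define M where "M = incidence_matrix \<sigma>"
  define h :: "nat \<Rightarrow> int" where "h n = of_bool (M *v x + abelianization (take n w) \<in> U)" for n
  have "dual_map \<sigma> (coboundary U) (x, i) = (\<Sum>n<length w. h (Suc n) - h n)"
    unfolding dual_map_def prod.case w_def [symmetric] M_def [symmetric]
  proof (rule sum.cong [OF refl])
    fix n assume "n \<in> {..<length w}"
    then have "abelianization (take (Suc n) w) = abelianization (take n w) + letter_vec (w ! n)"
      by (simp add: abelianization_def take_Suc_conv_app_nth)
    then have Suc: "M *v x + abelianization (take (Suc n) w)
        = M *v x + abelianization (take n w) + letter_vec (w ! n)"
      by (simp only: add.assoc)
    show "(let y = M *v x + abelianization (take n w)
        in case w ! n of Pos j \<Rightarrow> coboundary U (y, j) | Neg j \<Rightarrow> - coboundary U (y - axis j 1, j))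
        = h (Suc n) - h n"
      by (cases "w ! n") (simp_all add: coboundary_def h_def Let_def Suc)
  qed
  also have "\<dots> = h (length w) - h 0"
    by (rule sum_lessThan_telescope)
  \<comment> \<open>Column \<open>i\<close> of the matrix is the Abelianization of \<open>w\<close>,
    so the path ends at \<open>M *v (x + axis i 1)\<close>.\<close>
  also have "abelianization w = M *v axis i 1"
    by (simp add: vec_eq_iff M_def incidence_matrix_def w_def matrix_vector_mult_def axis_def
        if_distrib cong: if_cong)
  then have "h (length w) - h 0 = coboundary {x. M *v x \<in> U} (x, i)"
    by (simp add: h_def coboundary_def matrix_vector_right_distrib abelianization_def)
  finally show "dual_map \<sigma> (coboundary U) (x, i) = coboundary {x. incidence_matrix \<sigma> *v x \<in> U} (x, i)"
    by (simp add: M_def)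
qed

section \<open>Surjectivity of unimodular matrices on the integer lattice\<close>

lemma det_real_of_int_matrix:
  "det (\<chi> i j. real_of_int (A i j) :: real ^ 'n ^ 'n::finite) = real_of_int (det (\<chi> i j. A i j))"
  by (simp add: det_def)

text \<open>Cramer's rule over the reals gives the solution, and a determinant of 1 or -1 leaves it
  integral.\<close>

lemma surj_mult_unimodular_matrix:
  fixes M :: "int ^ 'n ^ 'n::finite"
  assumes "det M = 1 \<or> det M = - 1"
  shows "surj ((*v) M)"
proof (rule surjI)
  fix b :: "int ^ 'n"
  define A :: "real ^ 'n ^ 'n" where "A = (\<chi> i j. real_of_int (M $ i $ j))"
  define D where "D k = det (\<chi> i j. if j = k then b $ i else M $ i $ j)" for k
  \<comment> \<open>Since \<open>det M\<close> is its own inverse, multiplying by it replaces the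
    division in Cramer's rule.\<close>
  define x where "x = (\<chi> k. D k * det M)"
  have dA: "det A = real_of_int (det M)"
    unfolding A_def det_real_of_int_matrix by simp
  have "real_of_int (x $ k)
      = det (\<chi> i j. if j = k then real_of_int (b $ i) else A $ i $ j) / det A" for k
  proof -
    have "det (\<chi> i j. if j = k then real_of_int (b $ i) else A $ i $ j)
        = det (\<chi> i j. real_of_int (if j = k then b $ i else M $ i $ j))"
      by (rule arg_cong [of _ _ det]) (simp add: vec_eq_iff A_def)
    then show ?thesis
      using assms by (auto simp: det_real_of_int_matrix x_def D_def dA)
  qed
  then have "A *v (\<chi> k. real_of_int (x $ k)) = (\<chi> k. real_of_int (b $ k))"
    using assms by (subst cramer) (auto simp: dA vec_eq_iff cong: if_cong)
  then have "real_of_int ((M *v x) $ k) = real_of_int (b $ k)" for k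
    by (simp add: vec_eq_iff matrix_vector_mult_def A_def)
  then show "M *v (\<chi> k. det (\<chi> i j. if j = k then b $ i else M $ i $ j) * det M) = b"
    by (simp add: vec_eq_iff x_def D_def)
qed

section \<open>Facets\<close>

lemma mem_facet_iff:
  "p \<in> facet x i \<longleftrightarrow> p $ i = x $ i + 1 \<and> (\<forall>j. j \<noteq> i \<longrightarrow> x $ j \<le> p $ j \<and> p $ j \<le> x $ j + 1)"
proof -
  have comp: "((\<chi> k. real_of_int (x $ k)) + axis i 1 + (\<Sum>j\<in>UNIV - {i}. c j *\<^sub>R axis j 1)) $ k
      = x $ k + (if k = i then 1 else c k)" for c :: "'a \<Rightarrow> real" and k
    by (simp add: axis_def if_distrib sum.delta cong: if_cong)
  show ?thesis
  proof
    assume "p \<in> facet x i"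
    then obtain c where "p = (\<chi> k. real_of_int (x $ k)) + axis i 1 + (\<Sum>j\<in>UNIV - {i}. c j *\<^sub>R axis j 1)"
      and "\<forall>j\<in>UNIV - {i}. 0 \<le> c j \<and> c j \<le> 1"
      unfolding facet_def by blast
    moreover from this(1) have "p $ k = x $ k + (if k = i then 1 else c k)" for k
      using comp [of c k] by metis
    ultimately show "p $ i = x $ i + 1 \<and> (\<forall>j. j \<noteq> i \<longrightarrow> x $ j \<le> p $ j \<and> p $ j \<le> x $ j + 1)"
      by (simp del: vector_add_component sum_component)
  next
    assume *: "p $ i = x $ i + 1 \<and> (\<forall>j. j \<noteq> i \<longrightarrow> x $ j \<le> p $ j \<and> p $ j \<le> x $ j + 1)"
    show "p \<in> facet x i"
      unfolding facet_def
    proof (intro CollectI exI [of _ "\<lambda>j. p $ j - x $ j"] conjI)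
      show "p = (\<chi> k. real_of_int (x $ k)) + axis i 1
          + (\<Sum>j\<in>UNIV - {i}. (p $ j - x $ j) *\<^sub>R axis j 1)"
        using * by (simp only: vec_eq_iff comp) auto
    qed (use * in auto)
  qed
qed

lemma mem_geometric_interpretation:
  "p \<in> geometric_interpretation B \<longleftrightarrow> (\<exists>x i. B (x, i) = 1 \<and> p \<in> facet x i)"
  by (auto simp: geometric_interpretation_def)

section \<open>Stepped surfaces are coboundaries\<close>

text \<open>This is the coordinate along (1,...,1): every \<open>p\<close> equals
  \<open>diagonal_projection p + vec (mean p)\<close>.\<close>

definition mean :: "real ^ 'd::finite \<Rightarrow> real" where
  "mean p = (\<Sum>k\<in>UNIV. p $ k) / real CARD('d)"

lemma diagonal_projection_eq: "diagonal_projection p = p - vec (mean p)"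
  by (simp add: diagonal_projection_def mean_def vec_eq_iff)

lemma mean_add_vec [simp]: "mean (p + vec t) = mean p + t"
  by (simp add: mean_def sum.distrib add_divide_distrib)

lemma diagonal_projection_add_vec [simp]: "diagonal_projection (p + vec t) = diagonal_projection p"
  by (simp add: diagonal_projection_eq vec_eq_iff)

lemma mean_diagonal_plane: "q \<in> diagonal_plane \<Longrightarrow> mean q = 0"
  by (simp add: mean_def diagonal_plane_def)

lemma continuous_on_mean [continuous_intros]: "continuous_on S mean"
  unfolding mean_def by (intro continuous_intros) simp

lemma continuous_on_diagonal_projection: "continuous_on S diagonal_projection"
  unfolding diagonal_projection_def by (intro continuous_intros) simp

text \<open>The half-integer coordinates keep these test points off every facet.\<close>

definition cube_center :: "int ^ 'd::finite \<Rightarrow> real ^ 'd" where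
  "cube_center x = (\<chi> k. x $ k + 1/2)"

lemma nonzero_on_segment_sign:
  fixes H :: "real ^ 'd::finite \<Rightarrow> real"
  assumes "continuous_on UNIV H" and "\<And>p. p \<in> closed_segment a b \<Longrightarrow> H p \<noteq> 0"
  shows "H a > 0 \<longleftrightarrow> H b > 0"
proof (rule ccontr)
  assume *: "\<not> (H a > 0 \<longleftrightarrow> H b > 0)"
  have conn: "connected (H ` closed_segment a b)"
    by (intro connected_continuous_image continuous_on_subset [OF assms(1)]) auto
  have ends: "H a \<in> H ` closed_segment a b" "H b \<in> H ` closed_segment a b"
    by auto
  have "H a \<le> 0 \<and> 0 \<le> H b \<or> H b \<le> 0 \<and> 0 \<le> H a"
    using * by linarith
  then have "0 \<in> H ` closed_segment a b"
    using connectedD_interval [OF conn ends] connectedD_interval [OF conn ends(2,1)] by blast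
  then show False
    using assms(2) by auto
qed

text \<open>The signed height above the surface along the diagonal is continuous and vanishes
  exactly on the surface; \<open>U\<close> collects the cubes whose centers have positive height.
  Between adjacent cubes the sign can change only across a facet of the surface, and there it
  must.\<close>

lemma stepped_surface_imp_coboundary:
  fixes B :: "'d::finite stepped_function"
  assumes "B \<in> stepped_surfaces"
  obtains U where "B = coboundary U" "U \<noteq> {}" "U \<noteq> UNIV"
proof -
  from assms obtain g where bin: "\<And>x i. B (x, i) = 0 \<or> B (x, i) = 1"
    and hom: "homeomorphism (geometric_interpretation B) diagonal_plane diagonal_projection g"
    by (auto simp: stepped_surfaces_def binary_functions_def)
  \<comment> \<open>\<open>g\<close> lifts the projection of \<open>p\<close> back to the surface,
    so \<open>H p\<close> is the signed height of \<open>p\<close> above it.\<close>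
  define H where "H p = mean p - mean (g (diagonal_projection p))" for p
  have H_vec: "H (p + vec t) = H p + t" for p t
    by (simp add: H_def)
  have "continuous_on (UNIV :: (real ^ 'd) set) (\<lambda>p. g (diagonal_projection p))"
    using hom diagonal_projection_in_plane
    by (intro continuous_on_compose2 [OF _ continuous_on_diagonal_projection]) (auto simp: homeomorphism_def)
  then have "continuous_on UNIV (\<lambda>p. mean (g (diagonal_projection p)))"
    by (rule continuous_on_compose2 [OF continuous_on_mean [of UNIV]]) simp
  then have "continuous_on UNIV (\<lambda>p. mean p - mean (g (diagonal_projection p)))"
    by (rule continuous_on_diff [OF continuous_on_mean])
  then have H_cont: "continuous_on UNIV H"
    by (simp add: H_def [abs_def])
  have H_zero: "H p = 0 \<longleftrightarrow> p \<in> geometric_interpretation B" for p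
  proof
    assume "H p = 0"
    let ?r = "g (diagonal_projection p)"
    have "diagonal_projection ?r = diagonal_projection p" and r: "?r \<in> geometric_interpretation B"
      using hom diagonal_projection_in_plane [of p] by (auto simp: homeomorphism_def)
    \<comment> \<open>Equal projections and equal means force equal points.\<close>
    then have "?r = p"
      using \<open>H p = 0\<close> by (simp add: H_def diagonal_projection_eq)
    then show "p \<in> geometric_interpretation B"
      using r by simp
  next
    assume "p \<in> geometric_interpretation B"
    then show "H p = 0"
      using hom by (auto simp: homeomorphism_def H_def)
  qed
  define U where "U = {x. H (cube_center x) > 0}"
  have step: "x + axis i 1 \<in> U \<longleftrightarrow> x \<in> U" if "B (x, i) = 0" for x i
  proof -
    \<comment> \<open>The only facet that the segment joining the two centers can meet is
      \<open>(x, i)\<close>, which is absent because \<open>B (x, i) = 0\<close>.\<close>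
    have "H p \<noteq> 0" if "p \<in> closed_segment (cube_center x) (cube_center (x + axis i 1))" for p
    proof
      assume "H p = 0"
      then obtain y j where yj: "B (y, j) = 1" "p \<in> facet y j"
        by (auto simp: H_zero mem_geometric_interpretation)
      from that obtain u where "0 \<le> u" "u \<le> 1"
        and "p = (1 - u) *\<^sub>R cube_center x + u *\<^sub>R cube_center (x + axis i 1)"
        by (auto simp: in_segment)
      then have p: "p $ k = x $ k + 1/2 + (if k = i then u else 0)" for k
        by (simp add: cube_center_def axis_def) argo
      \<comment> \<open>Outside direction \<open>i\<close> the coordinates of \<open>p\<close> are
        half-integers, but the \<open>j\<close>-th coordinate on a facet of direction
        \<open>j\<close> is an integer; doubling turns this into a parity clash.\<close>
      have [simp]: "j = i"
      proof (rule ccontr)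
        assume "j \<noteq> i"
        then have "real_of_int (2 * (y $ j + 1)) = real_of_int (2 * x $ j + 1)"
          using yj p [of j] by (simp add: mem_facet_iff)
        then have "2 * (y $ j + 1) = 2 * x $ j + 1"
          by (simp only: of_int_eq_iff)
        then show False by presburger
      qed
      have "y $ k = x $ k" for k
      proof -
        have "real_of_int (y $ k) < real_of_int (x $ k + 1)" "real_of_int (x $ k) < real_of_int (y $ k + 1)"
          using yj(2) p [of k] \<open>0 \<le> u\<close> \<open>u \<le> 1\<close> by (cases "k = i"; auto simp: mem_facet_iff)+
        then show ?thesis
          unfolding of_int_less_iff by linarith
      qed
      then have "y = x"
        by (simp add: vec_eq_iff)
      then show False
        using yj \<open>j = i\<close> that \<open>B (x, i) = 0\<close> by simp
    qed
    then show ?thesis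
      using nonzero_on_segment_sign [OF H_cont] by (auto simp: U_def)
  qed
  text \<open>An open unit cube does not meet the surface.\<close>
  have cube: "H p > 0 \<longleftrightarrow> x \<in> U" if inside: "\<And>k. x $ k < p $ k \<and> p $ k < x $ k + 1" for p x
  proof -
    have "H r \<noteq> 0" if r: "r \<in> closed_segment p (cube_center x)" for r
    proof
      assume "H r = 0"
      then obtain y j where "r \<in> facet y j"
        by (auto simp: H_zero mem_geometric_interpretation)
      then have j: "r $ j = real_of_int (y $ j + 1)"
        by (simp add: mem_facet_iff)
      have "r $ j \<in> closed_segment (p $ j) (x $ j + 1/2)"
        using r by (auto simp: in_segment cube_center_def)
      then have "x $ j < r $ j \<and> r $ j < x $ j + 1"
        using inside [of j] by (auto simp: closed_segment_eq_real_ivl split: if_splits)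
      then have "real_of_int (x $ j) < real_of_int (y $ j + 1)"
        "real_of_int (y $ j + 1) < real_of_int (x $ j + 1)"
        unfolding j by simp_all
      then show False
        unfolding of_int_less_iff by linarith
    qed
    then show ?thesis
      using nonzero_on_segment_sign [OF H_cont] by (auto simp: U_def)
  qed
  have jump: "x \<notin> U \<and> x + axis i 1 \<in> U" if "B (x, i) = 1" for x i
  proof -
    \<comment> \<open>\<open>m\<close> is the center of the facet; moving by 1/4 or -1/4 along the
      diagonal lands in the open cube at \<open>x + axis i 1\<close> or at \<open>x\<close>.\<close>
    define m where "m = (\<chi> k. x $ k + (if k = i then 1 else 1/2 :: real))"
    have "m \<in> facet x i"
      by (simp add: mem_facet_iff m_def)
    then have "H m = 0"
      using that by (auto simp: H_zero mem_geometric_interpretation)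
    then have "H (m + vec (1/4)) > 0" "\<not> H (m + vec (- 1/4)) > 0"
      unfolding H_vec by simp_all
    moreover have "H (m + vec (1/4)) > 0 \<longleftrightarrow> x + axis i 1 \<in> U"
      by (rule cube) (simp add: m_def axis_def)
    moreover have "H (m + vec (- 1/4)) > 0 \<longleftrightarrow> x \<in> U"
      by (rule cube) (simp add: m_def axis_def)
    ultimately show ?thesis by simp
  qed
  have "B = coboundary U"
  proof (rule ext, clarify)
    fix x i
    show "B (x, i) = coboundary U (x, i)"
      using bin [of x i] step [of x i] jump [of x i] by (auto simp: coboundary_def)
  qed
  moreover have diag: "H (cube_center (vec n)) = H (cube_center 0) + n" for n :: int
  proof -
    have "cube_center (vec n :: int ^ 'd) = cube_center 0 + vec (real_of_int n)"
      by (simp add: cube_center_def vec_eq_iff)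
    then show ?thesis
      by (simp add: H_vec)
  qed
  have "vec (\<lceil>- H (cube_center 0)\<rceil> + 1) \<in> U" "vec \<lfloor>- H (cube_center 0)\<rfloor> \<notin> U"
    unfolding U_def mem_Collect_eq diag by linarith+
  then have "U \<noteq> {}" "U \<noteq> UNIV"
    by auto
  ultimately show thesis
    using that by blast
qed

section \<open>Binary coboundaries are stepped surfaces\<close>

text \<open>On a walk from \<open>x\<close> to \<open>y\<close> by unit steps that stay below
  \<open>y\<close>, \<open>P\<close> must turn true at some step. The induction is on the number of
  steps left.\<close>

lemma lattice_path_crossing:
  fixes x y :: "int ^ 'd::finite"
  assumes "\<And>k. x $ k \<le> y $ k" and "\<not> P x" and "P y"
  obtains z i where "\<And>k. x $ k \<le> z $ k" "\<And>k. (z + axis i 1) $ k \<le> y $ k"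
    "\<not> P z" "P (z + axis i 1)"
proof -
  have "\<exists>z i. (\<forall>k. x $ k \<le> z $ k) \<and> (\<forall>k. (z + axis i 1) $ k \<le> y $ k) \<and> \<not> P z \<and> P (z + axis i 1)"
    using assms
  proof (induction "nat (\<Sum>k\<in>UNIV. y $ k - x $ k)" arbitrary: x rule: less_induct)
    case less
    have "x \<noteq> y"
      using less.prems by auto
    then obtain i where i: "x $ i \<noteq> y $ i"
      by (auto simp: vec_eq_iff)
    let ?x = "x + axis i 1"
    have le: "?x $ k \<le> y $ k" for k
      using less.prems(1) [of k] i by (auto simp: axis_def)
    show ?case
    proof (cases "P ?x")
      case True
      then show ?thesis
        using less.prems le by blast
    next
      case False
      have "(\<Sum>k\<in>UNIV. y $ k - ?x $ k) < (\<Sum>k\<in>UNIV. y $ k - x $ k)"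
        by (rule sum_strict_mono_ex1) (auto simp: axis_def)
      moreover have "0 \<le> (\<Sum>k\<in>UNIV. y $ k - ?x $ k)"
        using le by (intro sum_nonneg) (simp add: algebra_simps)
      ultimately obtain z j where zj: "\<forall>k. ?x $ k \<le> z $ k" "\<forall>k. (z + axis j 1) $ k \<le> y $ k"
        "\<not> P z" "P (z + axis j 1)"
        using less.hyps [of ?x] le False less.prems(3) by (auto simp del: vector_add_component)
      have "x $ k \<le> z $ k" for k
        using zj(1) [rule_format, of k] by (auto simp: axis_def split: if_splits)
      then show ?thesis
        using zj by blast
    qed
  qed
  then show thesis
    using that by blast
qed

text \<open>A monotone path leaving \<open>U\<close> would contain an edge on which the coboundary
  is -1.\<close>

lemma binary_coboundary_upward_closed:
  assumes "coboundary U \<in> binary_functions" and "x \<in> U" and "\<And>k. x $ k \<le> y $ k"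
  shows "y \<in> U"
proof (rule ccontr)
  assume "y \<notin> U"
  then obtain z i where "z \<in> U" "z + axis i 1 \<notin> U"
    by (rule lattice_path_crossing [of x y "\<lambda>z. z \<notin> U", rotated 2]) (use assms(2,3) in auto)
  then have "coboundary U (z, i) = - 1"
    by (simp add: coboundary_def)
  moreover have "coboundary U (z, i) \<in> {0, 1}"
    using assms(1) unfolding binary_functions_def by blast
  ultimately show False
    by simp
qed

text \<open>The closed unit cubes containing \<open>p\<close> are those with lower corner between
  \<open>\<lceil>p $ k\<rceil> - 1\<close> and \<open>\<lfloor>p $ k\<rfloor>\<close> in each
  coordinate. As \<open>U\<close> is upward closed, it separates two of them iff it contains the
  greatest corner but not the least.\<close>

lemma geometric_interpretation_coboundary:
  assumes "coboundary U \<in> binary_functions"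
  shows "p \<in> geometric_interpretation (coboundary U) \<longleftrightarrow>
    (\<chi> k. \<lfloor>p $ k\<rfloor>) \<in> U \<and> (\<chi> k. \<lceil>p $ k\<rceil> - 1) \<notin> U"
proof
  assume "p \<in> geometric_interpretation (coboundary U)"
  then obtain x i where xi: "x \<notin> U" "x + axis i 1 \<in> U" "p \<in> facet x i"
    by (auto simp: mem_geometric_interpretation coboundary_def of_bool_def split: if_splits)
  have "(x + axis i 1) $ k \<le> \<lfloor>p $ k\<rfloor> \<and> \<lceil>p $ k\<rceil> - 1 \<le> x $ k" for k
    using xi(3) by (cases "k = i") (auto simp: mem_facet_iff axis_def le_floor_iff diff_le_eq ceiling_le_iff)
  then show "(\<chi> k. \<lfloor>p $ k\<rfloor>) \<in> U \<and> (\<chi> k. \<lceil>p $ k\<rceil> - 1) \<notin> U"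
    using binary_coboundary_upward_closed [OF assms, of "x + axis i 1" "\<chi> k. \<lfloor>p $ k\<rfloor>"]
      binary_coboundary_upward_closed [OF assms, of "\<chi> k. \<lceil>p $ k\<rceil> - 1" x] xi(1,2)
    by auto
next
  assume *: "(\<chi> k. \<lfloor>p $ k\<rfloor>) \<in> U \<and> (\<chi> k. \<lceil>p $ k\<rceil> - 1) \<notin> U"
  define a where "a = (\<chi> k. \<lceil>p $ k\<rceil> - 1)"
  define b where "b = (\<chi> k. \<lfloor>p $ k\<rfloor>)"
  have le: "a $ k \<le> b $ k" for k
    unfolding a_def b_def by simp linarith
  have "a \<notin> U" "b \<in> U"
    using * by (simp_all add: a_def b_def)
  then obtain z i where zi: "\<And>k. a $ k \<le> z $ k" "\<And>k. (z + axis i 1) $ k \<le> b $ k"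
    "z \<notin> U" "z + axis i 1 \<in> U"
    using lattice_path_crossing [of a b "\<lambda>z. z \<in> U"] le by blast
  have "p $ k \<le> z $ k + 1" for k
    using zi(1) [of k] by (simp add: a_def) linarith
  moreover have "z $ k \<le> p $ k" for k
    using zi(2) [of k] by (cases "k = i") (simp_all add: b_def axis_def le_floor_iff)
  moreover have "z $ i + 1 \<le> p $ i"
    using zi(2) [of i] by (simp add: b_def le_floor_iff)
  \<comment> \<open>In direction \<open>i\<close> the upper and lower bounds agree and pin
    \<open>p $ i\<close> to \<open>z $ i + 1\<close>.\<close>
  ultimately have "p \<in> facet z i"
    unfolding mem_facet_iff by (simp add: antisym)
  then show "p \<in> geometric_interpretation (coboundary U)"
    using zi(3,4) by (auto simp: mem_geometric_interpretation coboundary_def)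
qed

text \<open>If \<open>p'\<close> exceeded \<open>p\<close> in every coordinate, the greatest corner
  at \<open>p\<close>, in \<open>U\<close>, would lie below the least corner at \<open>p'\<close>,
  outside \<open>U\<close>, against upward closure. Uniqueness and Lipschitz continuity of the
  height both rest on this.\<close>

lemma geometric_interpretation_coboundary_antichain:
  assumes "coboundary U \<in> binary_functions"
    and "p \<in> geometric_interpretation (coboundary U)"
    and "p' \<in> geometric_interpretation (coboundary U)"
  obtains k where "p' $ k \<le> p $ k"
proof -
  have "\<exists>k. p' $ k \<le> p $ k"
  proof (rule ccontr)
    assume "\<not> ?thesis"
    then have "p $ k < p' $ k" for k
      by (auto simp: not_le)
    then have "\<lfloor>p $ k\<rfloor> \<le> \<lceil>p' $ k\<rceil> - 1" for k
      by (smt (verit) floor_correct le_of_int_ceiling of_int_less_iff)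
    then show False
      using binary_coboundary_upward_closed [OF assms(1), of "\<chi> k. \<lfloor>p $ k\<rfloor>" "\<chi> k. \<lceil>p' $ k\<rceil> - 1"]
        assms(2,3) by (simp add: geometric_interpretation_coboundary [OF assms(1)])
  qed
  then show thesis
    using that by blast
qed

lemma floor_one_sided_limits:
  fixes a :: "'d::finite \<Rightarrow> real"
  obtains e where "e > 0" "\<And>s k. 0 < s \<Longrightarrow> s < e \<Longrightarrow> \<lfloor>a k + s\<rfloor> = \<lfloor>a k\<rfloor>"
    "\<And>s k. 0 < s \<Longrightarrow> s < e \<Longrightarrow> \<lfloor>a k - s\<rfloor> = \<lceil>a k\<rceil> - 1"
proof -
  \<comment> \<open>The least distance from any \<open>a k\<close> to the next integer strictly
    above or strictly below it; finiteness of the index type makes it positive.\<close>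
  define e where "e = Min (range (\<lambda>k. min (\<lfloor>a k\<rfloor> + 1 - a k) (a k - (\<lceil>a k\<rceil> - 1))))"
  have "e > 0"
    unfolding e_def by (subst Min_gr_iff) (auto, linarith+)
  have le: "e \<le> \<lfloor>a k\<rfloor> + 1 - a k" "e \<le> a k - (\<lceil>a k\<rceil> - 1)" for k
  proof -
    have "e \<le> min (\<lfloor>a k\<rfloor> + 1 - a k) (a k - (\<lceil>a k\<rceil> - 1))"
      unfolding e_def by (rule Min_le) auto
    then show "e \<le> \<lfloor>a k\<rfloor> + 1 - a k" "e \<le> a k - (\<lceil>a k\<rceil> - 1)"
      by auto
  qed
  show thesis
  proof
    show "\<lfloor>a k + s\<rfloor> = \<lfloor>a k\<rfloor>" if "0 < s" "s < e" for s k
      using le(1) [of k] that by linarith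
    show "\<lfloor>a k - s\<rfloor> = \<lceil>a k\<rceil> - 1" if "0 < s" "s < e" for s k
      using le(2) [of k] that by linarith
  qed fact
qed

text \<open>Moving up the diagonal through \<open>q\<close>, the floor corner enters
  \<open>U\<close> at a threshold \<open>T\<close>. The right and left limits of the floor at
  \<open>T\<close> are exactly the two corners in the floor-ceiling criterion for the
  surface.\<close>

lemma diagonal_meets_coboundary:
  fixes U :: "(int ^ 'd::finite) set"
  assumes bin: "coboundary U \<in> binary_functions" and "U \<noteq> {}" "U \<noteq> UNIV"
  obtains t where "q + vec t \<in> geometric_interpretation (coboundary U)"
proof -
  define F where "F t = (\<chi> k. \<lfloor>q $ k + t\<rfloor>)" for t
  define S where "S = {t. F t \<in> U}"
  have up: "y \<in> U" if "x \<in> U" "\<And>k. x $ k \<le> y $ k" for x y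
    by (rule binary_coboundary_upward_closed [OF bin that])
  have S_up: "t' \<in> S" if "t \<in> S" "t \<le> t'" for t t'
  proof -
    have "F t $ k \<le> F t' $ k" for k
      using that(2) by (simp add: F_def floor_mono)
    then show ?thesis
      using that(1) up by (auto simp: S_def)
  qed
  obtain u v where "u \<in> U" "v \<notin> U"
    using assms(2,3) by auto
  \<comment> \<open>Shifting \<open>q\<close> up by this sum for \<open>u\<close> brings
    \<open>F\<close> above \<open>u\<close>; shifting down by more than this sum for
    \<open>v\<close> brings it below \<open>v\<close>.\<close>
  have bound: "\<bar>w $ k - q $ k\<bar> \<le> (\<Sum>k\<in>UNIV. \<bar>w $ k - q $ k\<bar>)" for w :: "int ^ 'd" and k
    by (rule member_le_sum) auto
  have "u $ k \<le> F (\<Sum>k\<in>UNIV. \<bar>u $ k - q $ k\<bar>) $ k" for k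
    using bound [of u k] by (simp add: F_def le_floor_iff)
  then have "S \<noteq> {}"
    using up \<open>u \<in> U\<close> unfolding S_def by blast
  have lower: "- (\<Sum>k\<in>UNIV. \<bar>v $ k - q $ k\<bar>) \<le> t" if "t \<in> S" for t
  proof (rule ccontr)
    assume t: "\<not> ?thesis"
    have "F t $ k \<le> v $ k" for k
      using bound [of v k] t by (simp add: F_def floor_le_iff)
    then show False
      using that up \<open>v \<notin> U\<close> unfolding S_def by blast
  qed
  then have bdd: "bdd_below S"
    by (rule bdd_belowI)
  define T where "T = Inf S"
  have above: "t \<in> S" if "T < t" for t
    using that S_up cInf_lessD [OF \<open>S \<noteq> {}\<close>] unfolding T_def by (meson less_imp_le)
  have below: "t \<notin> S" if "t < T" for t
    using that cInf_lower [OF _ bdd] unfolding T_def by (meson not_le)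
  obtain e where e: "e > 0" "\<And>s k. 0 < s \<Longrightarrow> s < e \<Longrightarrow> \<lfloor>(q $ k + T) + s\<rfloor> = \<lfloor>q $ k + T\<rfloor>"
    "\<And>s k. 0 < s \<Longrightarrow> s < e \<Longrightarrow> \<lfloor>(q $ k + T) - s\<rfloor> = \<lceil>q $ k + T\<rceil> - 1"
    using floor_one_sided_limits [of "\<lambda>k. q $ k + T"] by blast
  have "F (T + e/2) = F T" and "F (T - e/2) = (\<chi> k. \<lceil>q $ k + T\<rceil> - 1)"
    using e(1) e(2,3) [of "e/2"] by (simp_all add: F_def vec_eq_iff algebra_simps)
  then have "F T \<in> U" "(\<chi> k. \<lceil>q $ k + T\<rceil> - 1) \<notin> U"
    using above [of "T + e/2"] below [of "T - e/2"] e(1) by (simp_all add: S_def)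
  then have "q + vec T \<in> geometric_interpretation (coboundary U)"
    by (simp add: geometric_interpretation_coboundary [OF bin] F_def)
  then show thesis
    using that by blast
qed

text \<open>Each diagonal line meets the surface exactly once, at a height that is 1-Lipschitz in
  the base point; lifting by this height is a continuous inverse of the projection.\<close>

lemma binary_coboundary_is_stepped_surface:
  fixes U :: "(int ^ 'd::finite) set"
  assumes bin: "coboundary U \<in> binary_functions" and "U \<noteq> {}" "U \<noteq> UNIV"
  shows "coboundary U \<in> stepped_surfaces"
proof -
  let ?G = "geometric_interpretation (coboundary U)"
  have "\<forall>q. \<exists>t. q + vec t \<in> ?G"
    using diagonal_meets_coboundary [OF assms] by metis
  then obtain \<tau> where \<tau>: "\<And>q. q + vec (\<tau> q) \<in> ?G"
    by metis
  \<comment> \<open>The antichain property supplies a coordinate in which the second point is not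
    higher. The case \<open>q = q'\<close>, used in both directions, shows that the height is
    unique.\<close>
  have height_le: "t' \<le> t + dist q q'" if mem: "q + vec t \<in> ?G" "q' + vec t' \<in> ?G" for q q' t t'
  proof -
    obtain k where "q' $ k + t' \<le> q $ k + t"
      using geometric_interpretation_coboundary_antichain [OF bin mem] by auto
    moreover have "\<bar>(q - q') $ k\<bar> \<le> dist q q'"
      unfolding dist_norm by (rule component_le_norm_cart)
    ultimately show ?thesis
      by simp
  qed
  have "1-lipschitz_on UNIV \<tau>"
  proof (rule lipschitz_onI)
    fix q q'
    show "dist (\<tau> q) (\<tau> q') \<le> 1 * dist q q'"
      using height_le [OF \<tau> \<tau>, of q q'] height_le [OF \<tau> \<tau>, of q' q]
      by (simp add: dist_real_def dist_commute abs_le_iff)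
  qed simp
  then have \<tau>_cont: "continuous_on UNIV \<tau>"
    by (rule lipschitz_on_continuous_on)
  define g where "g q = q + vec (\<tau> q)" for q
  have "homeomorphism ?G diagonal_plane diagonal_projection g"
  proof
    show "continuous_on ?G diagonal_projection"
      by (rule continuous_on_diagonal_projection)
    show "continuous_on diagonal_plane g"
      unfolding g_def vec_def
      by (intro continuous_intros continuous_on_subset [OF \<tau>_cont]) auto
    show "diagonal_projection ` ?G \<subseteq> diagonal_plane"
      using diagonal_projection_in_plane by auto
    show "g ` diagonal_plane \<subseteq> ?G"
      using \<tau> by (auto simp: g_def)
    show "g (diagonal_projection p) = p" if "p \<in> ?G" for p
    proof -
      have "diagonal_projection p + vec (mean p) \<in> ?G"
        using that by (simp add: diagonal_projection_eq)
      then have "\<tau> (diagonal_projection p) = mean p"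
        using height_le [OF _ \<tau>, of "diagonal_projection p" "mean p" "diagonal_projection p"]
          height_le [OF \<tau>, of "diagonal_projection p" "mean p" "diagonal_projection p"] by simp
      then show ?thesis
        by (simp add: g_def) (simp add: diagonal_projection_eq)
    qed
    show "diagonal_projection (g q) = q" if "q \<in> diagonal_plane" for q
      using mean_diagonal_plane [OF that] by (simp add: g_def) (simp add: diagonal_projection_eq vec_eq_iff)
  qed
  then show ?thesis
    using bin by (auto simp: stepped_surfaces_def)
qed

theorem theorem4p12:
  fixes \<sigma> :: "'d::finite word \<Rightarrow> 'd word"
  assumes "CARD('d) \<ge> 3"
    and "\<sigma> \<in> hom free_group free_group"
    and "unimodular \<sigma>"
  shows "dual_map \<sigma> ` stepped_surfaces \<inter> binary_functions \<subseteq> stepped_surfaces"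
proof clarify
  fix B :: "'d stepped_function"
  assume "B \<in> stepped_surfaces" and bin: "dual_map \<sigma> B \<in> binary_functions"
  then obtain U where B: "B = coboundary U" and U: "U \<noteq> {}" "U \<noteq> UNIV"
    using stepped_surface_imp_coboundary by metis
  let ?V = "{x. incidence_matrix \<sigma> *v x \<in> U}"
  \<comment> \<open>A point of \<open>U\<close> and a point outside \<open>U\<close> both have
    preimages, so \<open>?V\<close> is again nonempty and proper.\<close>
  have surj: "surj ((*v) (incidence_matrix \<sigma>))"
    using assms(3) by (intro surj_mult_unimodular_matrix) (simp add: unimodular_def)
  have "?V \<noteq> {}"
    using U(1) surj by (metis (mono_tags, lifting) all_not_in_conv mem_Collect_eq surj_def)
  moreover have "?V \<noteq> UNIV"
    using U(2) surj by (metis (mono_tags, lifting) UNIV_I UNIV_eq_I mem_Collect_eq surj_def)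
  ultimately show "dual_map \<sigma> B \<in> stepped_surfaces"
    using bin unfolding B dual_map_coboundary by (intro binary_coboundary_is_stepped_surface)
qed

end
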